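(* Let $\lambda>0$, let $T=\begin{pmatrix}A&B\\C&D\end{pmatrix}\in\mathcal{B}(\mathcal{H})$ with $T\in\phi(M,N,\lambda)$, and let $\{\alpha_n\}_{n\ge 1}$ be a sequence of scalars. (1) $\alpha_nT^n\in\phi(M,N,\lambda)$ for all $n\in\mathbb{N}$. Moreover, if $\alpha_nT^n\to\widetilde{T}$ uniformly (that is, in operator norm) in $\mathcal{B}(\mathcal{H})$ and $\widetilde{T}\in\mathcal{C}_D(M,N)$, then $\widetilde{T}\in\psi(M,N,\lambda)$. (2) $S_n=\sum_{i=1}^{n}\alpha_iT^i\in\psi(M,N,\lambda)$ for all $n\in\mathbb{N}$. (3) If there exists $\beta<1$ such that $|\alpha_n|^{1/n}\|T\|\le\beta$ for all $n\in\mathbb{N}$, then $\sum_{n=1}^{\infty}\alpha_nT^n$ converges in $\mathcal{B}(\mathcal{H})$. Moreover, if $\sum_{n=1}^{\infty}\alpha_nT^n\in\mathcal{C}_D(M,N)$, then $\sum_{n=1}^{\infty}\alpha_nT^n\in\psi(M,N,\lambda)$.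
   Context: $\mathcal{H}$ is a real or complex Hilbert space, $\mathcal{B}(\mathcal{H})$ is the space of bounded linear operators on $\mathcal{H}$ with the operator norm, $M$ and $N$ are closed subspaces of $\mathcal{H}$, and $\mathbb{N}=\{1,2,\dots\}$. The symbol $*$ denotes the adjoint. Every linear operator $T$ on $\mathcal{H}$ is written $T=\begin{pmatrix}A&B\\C&D\end{pmatrix}$ with respect to the decomposition $\mathcal{H}=M\oplus M^\perp$ of the domain and $\mathcal{H}=N\oplus N^\perp$ of the codomain, so $A:M\to N$, $B:M^\perp\to N$, $C:M\to N^\perp$, $D:M^\perp\to N^\perp$. For a closed subspace $L$, $\mathcal{B}_L=\{x\in L:\|x\|\le1\}$. $\phi(M,N,\lambda)$ is the set of $T\in\mathcal{B}(\mathcal{H})$ satisfying both $(A+C)(\mathcal{B}_M)\subseteq\lambda(B+D)(\mathcal{B}_{M^\perp})$ and $(A^*+B^* )(\mathcal{B}_N)\subseteq\lambda(C^*+D^* )(\mathcal{B}_{N^\perp})$, where $(A+C)x=Ax+Cx\in\mathcal{H}$ for $x\in M$, and similarly for the other sums. $\psi(M,N,\lambda)$ is the set of $T\in\mathcal{B}(\mathcal{H})$ satisfying $C(\mathcal{B}_M)\subseteq\lambda D(\mathcal{B}_{M^\perp})$ and $B^*(\mathcal{B}_N)\subseteq\lambda D^*(\mathcal{B}_{N^\perp})$ (called $(M,N,\lambda)$-complementable operators). $\mathcal{C}_D(M,N)$ is the set of linear operators on $\mathcal{H}$ whose block $D$ has closed range. *)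

theory Defs
  imports "HOL-Analysis.Analysis"
begin

text \<open>The scalar field is real or complex. The axioms leave no other model: the field consists of
  the elements \<open>a + b * i\<close> with \<open>a, b\<close> real, where either \<open>i = 0\<close>
  (the reals; the norm axiom then forces the imaginary part to vanish) or \<open>i * i = -1\<close>
  (the complex numbers), with the usual absolute value.\<close>

class real_or_complex = real_normed_field +
  fixes re_part :: "'a \<Rightarrow> real"
    and im_part :: "'a \<Rightarrow> real"
    and imag_unit :: 'a
  assumes re_im_decomp: "re_part z *\<^sub>R 1 + im_part z *\<^sub>R imag_unit = z"
    and norm_re_im: "(norm z)\<^sup>2 = (re_part z)\<^sup>2 + (im_part z)\<^sup>2"
    and imag_unit_cases: "imag_unit = 0 \<or> imag_unit * imag_unit = - 1"

instantiation real :: real_or_complex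
begin
definition "re_part (x::real) = x"
definition "im_part (x::real) = (0::real)"
definition "imag_unit = (0::real)"
instance by standard (auto simp: re_part_real_def im_part_real_def imag_unit_real_def)
end

instantiation complex :: real_or_complex
begin
definition "re_part (z::complex) = Re z"
definition "im_part (z::complex) = Im z"
definition "imag_unit = \<i>"
instance
  by standard (auto simp: re_part_complex_def im_part_complex_def imag_unit_complex_def
      complex_eq_iff cmod_power2)
end

definition conjugate :: "'k::real_or_complex \<Rightarrow> 'k" where
  "conjugate z = re_part z *\<^sub>R 1 - im_part z *\<^sub>R imag_unit"

lemma conjugate_real [simp]: "conjugate (x::real) = x"
  by (simp add: conjugate_def re_part_real_def im_part_real_def)

lemma conjugate_complex [simp]: "conjugate (z::complex) = cnj z"
  by (simp add: conjugate_def re_part_complex_def im_part_complex_def imag_unit_complex_def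
      complex_eq_iff)

primrec op_power :: "('a::real_normed_vector \<Rightarrow>\<^sub>L 'a) \<Rightarrow> nat \<Rightarrow> ('a \<Rightarrow>\<^sub>L 'a)" where
  "op_power T 0 = id_blinfun"
| "op_power T (Suc n) = T o\<^sub>L op_power T n"

text \<open>Norm, topology and completeness come from the class \<open>banach\<close>; the locale ties them to
  the inner product \<open>ip\<close>, which is linear in its first argument. Inside the locale,
  \<open>subspace\<close> is the notion for the scalar field \<open>'k\<close>, inherited from
  \<open>vector_space\<close>.\<close>

locale hilbert_space = vector_space smult
  for smult :: "'k::real_or_complex \<Rightarrow> 'a::banach \<Rightarrow> 'a" +
  fixes ip :: "'a \<Rightarrow> 'a \<Rightarrow> 'k"
  assumes smult_of_real: "smult (of_real r) x = r *\<^sub>R x"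
    and ip_add_left: "ip (x + y) z = ip x z + ip y z"
    and ip_smult_left: "ip (smult c x) y = c * ip x y"
    and ip_commute: "ip y x = conjugate (ip x y)"
    and ip_self: "ip x x = of_real ((norm x)\<^sup>2)"
begin

definition closed_subspace :: "'a set \<Rightarrow> bool" where
  "closed_subspace L \<longleftrightarrow> subspace L \<and> closed L"

definition orth :: "'a set \<Rightarrow> 'a set" where
  "orth L = {y. \<forall>x\<in>L. ip x y = 0}"

definition proj :: "'a set \<Rightarrow> 'a \<Rightarrow> 'a" where
  "proj L x = (THE y. y \<in> L \<and> x - y \<in> orth L)"

definition unit_ball :: "'a set \<Rightarrow> 'a set" where
  "unit_ball L = {x \<in> L. norm x \<le> 1}"

text \<open>Elements of the type \<open>'a \<Rightarrow>\<^sub>L 'a\<close> are only real-linear, so linearity over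
  \<open>'k\<close> is required separately.\<close>

definition bounded_ops :: "('a \<Rightarrow>\<^sub>L 'a) set" where
  "bounded_ops = {T. Vector_Spaces.linear smult smult (blinfun_apply T)}"

definition op_scale :: "'k \<Rightarrow> ('a \<Rightarrow>\<^sub>L 'a) \<Rightarrow> ('a \<Rightarrow>\<^sub>L 'a)" where
  "op_scale c T = Blinfun (\<lambda>x. smult c (blinfun_apply T x))"

text \<open>The block of \<open>T\<close> mapping the subspace \<open>L\<close> of the domain to the subspace \<open>L'\<close> of the
  codomain, as a function on \<open>L\<close>. In a decomposition with respect to \<open>M\<close> and \<open>N\<close> the blocks are
  \<open>A = block M N T\<close>, \<open>B = block (orth M) N T\<close>,
  \<open>C = block M (orth N) T\<close> and \<open>D = block (orth M) (orth N) T\<close>.\<close>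

definition block :: "'a set \<Rightarrow> 'a set \<Rightarrow> ('a \<Rightarrow> 'a) \<Rightarrow> ('a \<Rightarrow> 'a)" where
  "block L L' T = (\<lambda>x\<in>L. proj L' (T x))"

text \<open>The Hilbert space adjoint of \<open>F : L \<rightarrow> L'\<close>, to be applied to vectors of \<open>L'\<close>; its values
  lie in \<open>L\<close>.\<close>

definition adj :: "'a set \<Rightarrow> ('a \<Rightarrow> 'a) \<Rightarrow> 'a \<Rightarrow> 'a" where
  "adj L F z = (THE y. y \<in> L \<and> (\<forall>x\<in>L. ip (F x) z = ip x y))"

definition phi :: "'a set \<Rightarrow> 'a set \<Rightarrow> real \<Rightarrow> ('a \<Rightarrow>\<^sub>L 'a) set" where
  "phi M N lam = {T \<in> bounded_ops.
     (let A = block M N (blinfun_apply T);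
          B = block (orth M) N (blinfun_apply T);
          C = block M (orth N) (blinfun_apply T);
          D = block (orth M) (orth N) (blinfun_apply T)
      in (\<lambda>x. A x + C x) ` unit_ball M
           \<subseteq> (\<lambda>z. lam *\<^sub>R z) ` (\<lambda>y. B y + D y) ` unit_ball (orth M) \<and>
         (\<lambda>x. adj M A x + adj (orth M) B x) ` unit_ball N
           \<subseteq> (\<lambda>z. lam *\<^sub>R z) ` (\<lambda>y. adj M C y + adj (orth M) D y) ` unit_ball (orth N))}"

definition psi :: "'a set \<Rightarrow> 'a set \<Rightarrow> real \<Rightarrow> ('a \<Rightarrow>\<^sub>L 'a) set" where
  "psi M N lam = {T \<in> bounded_ops.
     (let B = block (orth M) N (blinfun_apply T);
          C = block M (orth N) (blinfun_apply T);
          D = block (orth M) (orth N) (blinfun_apply T)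
      in C ` unit_ball M \<subseteq> (\<lambda>z. lam *\<^sub>R z) ` D ` unit_ball (orth M) \<and>
         adj (orth M) B ` unit_ball N
           \<subseteq> (\<lambda>z. lam *\<^sub>R z) ` adj (orth M) D ` unit_ball (orth N))}"

definition closed_range_D :: "'a set \<Rightarrow> 'a set \<Rightarrow> ('a \<Rightarrow> 'a) set" where
  "closed_range_D M N = {T. Vector_Spaces.linear smult smult T \<and>
     closed (block (orth M) (orth N) T ` orth M)}"

end

lemma hilbert_space_real:
  "hilbert_space (*\<^sub>R) (inner :: 'a::{real_inner,banach} \<Rightarrow> 'a \<Rightarrow> real)"
  by unfold_locales
    (auto simp: inner_left_distrib inner_right_distrib inner_commute power2_norm_eq_inner
      scaleR_right_distrib scaleR_left_distrib)

lemma hilbert_space_complex: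
  "hilbert_space (*) (\<lambda>x y :: complex. x * cnj y)"
  by unfold_locales
    (auto simp: algebra_simps scaleR_conv_of_real complex_norm_square simp del: of_real_power)

end

theory Submission
  imports Defs
begin

text \<open>Since \<open>T = A + B + C + D\<close>, membership in \<open>\<phi>\<close> says that \<open>T\<close> maps the unit ball of \<open>M\<close> into
  \<open>\<lambda>\<close> times the image of the unit ball of \<open>M\<^sup>\<bottom>\<close>, and likewise for the adjoint and \<open>N\<close>. Such an
  inclusion survives composition from the left, so \<open>R T\<close> lies in \<open>\<phi>\<close> for every \<open>R\<close> commuting
  with \<open>T\<close>; projecting gives \<open>\<phi> \<subseteq> \<psi>\<close>. Moreover \<open>\<phi>\<close> is closed in operator norm, because a bounded
  operator on a Hilbert space maps closed balls of closed subspaces to closed sets.\<close>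

section \<open>Conjugation on the scalar field\<close>

text \<open>If \<open>imag_unit\<close> squares to -1, squaring a real number that equals a real
  multiple of it shows that a sum of two real squares vanishes. If \<open>imag_unit = 0\<close>, the
  equation leaves \<open>b\<close> free, so the second claim compares only multiples of
  \<open>imag_unit\<close>.\<close>

lemma re_im_unique:
  fixes z :: "'k::real_or_complex"
  assumes "z = a *\<^sub>R 1 + b *\<^sub>R imag_unit"
  shows "re_part z = a" and "im_part z *\<^sub>R (imag_unit::'k) = b *\<^sub>R imag_unit"
proof -
  have *: "(re_part z - a) *\<^sub>R (1::'k) = (b - im_part z) *\<^sub>R imag_unit"
    using re_im_decomp[of z] assms by (simp add: algebra_simps)
  have "re_part z = a \<and> im_part z *\<^sub>R (imag_unit::'k) = b *\<^sub>R imag_unit"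
  proof (cases "imag_unit = (0::'k)")
    case False
    then have i: "imag_unit * imag_unit = (- 1 :: 'k)"
      using imag_unit_cases by auto
    have "((re_part z - a) *\<^sub>R (1::'k)) * ((re_part z - a) *\<^sub>R 1)
        = ((b - im_part z) *\<^sub>R imag_unit) * ((b - im_part z) *\<^sub>R imag_unit)"
      by (simp only: *)
    then have "of_real ((re_part z - a)\<^sup>2) = (of_real (- ((b - im_part z)\<^sup>2)) :: 'k)"
      using i by (simp add: of_real_def power2_eq_square)
    then have "(re_part z - a)\<^sup>2 = - ((b - im_part z)\<^sup>2)"
      by (simp only: of_real_eq_iff)
    then have "(re_part z - a)\<^sup>2 + (b - im_part z)\<^sup>2 = 0"
      by simp
    then show ?thesis
      by (auto simp: sum_power2_eq_zero_iff)
  qed (use * in auto)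
  then show "re_part z = a" and "im_part z *\<^sub>R (imag_unit::'k) = b *\<^sub>R imag_unit"
    by auto
qed

lemma conjugate_eqI:
  fixes z :: "'k::real_or_complex"
  assumes "z = a *\<^sub>R 1 + b *\<^sub>R imag_unit"
  shows "conjugate z = a *\<^sub>R 1 - b *\<^sub>R imag_unit"
  using re_im_unique[OF assms] by (simp add: conjugate_def)

lemma re_part_of_real [simp]: "re_part (of_real r :: 'k::real_or_complex) = r"
  by (rule re_im_unique(1)[where b = 0]) (simp add: of_real_def)

lemma conjugate_of_real [simp]: "conjugate (of_real r :: 'k::real_or_complex) = of_real r"
  by (subst conjugate_eqI[where a = r and b = 0]) (simp_all add: of_real_def)

lemma conjugate_zero [simp]: "conjugate (0 :: 'k::real_or_complex) = 0"
  using conjugate_of_real[of 0] by simp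

lemma conjugate_add: "conjugate (z + w) = conjugate z + conjugate (w :: 'k::real_or_complex)"
proof -
  have "z + w = (re_part z + re_part w) *\<^sub>R 1 + (im_part z + im_part w) *\<^sub>R imag_unit"
    using re_im_decomp[of z] re_im_decomp[of w] by (simp add: algebra_simps)
  from conjugate_eqI[OF this] show ?thesis
    by (simp add: conjugate_def algebra_simps)
qed

lemma conjugate_conjugate [simp]: "conjugate (conjugate z) = (z :: 'k::real_or_complex)"
proof -
  have "conjugate z = re_part z *\<^sub>R 1 + (- im_part z) *\<^sub>R imag_unit"
    by (simp add: conjugate_def)
  from conjugate_eqI[OF this] show ?thesis
    using re_im_decomp[of z] by simp
qed

lemma add_conjugate: "z + conjugate z = of_real (2 * re_part (z :: 'k::real_or_complex))"
proof -
  have "z + conjugate z = re_part z *\<^sub>R 1 + im_part z *\<^sub>R imag_unit + conjugate z"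
    by (simp only: re_im_decomp)
  also have "\<dots> = of_real (2 * re_part z)"
    by (simp add: conjugate_def scaleR_conv_of_real)
  finally show ?thesis .
qed

lemma conjugate_mult: "conjugate (z * w) = conjugate z * conjugate (w :: 'k::real_or_complex)"
proof (cases "imag_unit = (0::'k)")
  case True
  then have "conjugate u = u" for u :: 'k
    using re_im_decomp[of u] by (simp add: conjugate_def)
  then show ?thesis by simp
next
  case False
  then have i: "imag_unit * imag_unit = (- 1 :: 'k)"
    using imag_unit_cases by auto
  have "z * w = (re_part z *\<^sub>R 1 + im_part z *\<^sub>R imag_unit) * (re_part w *\<^sub>R 1 + im_part w *\<^sub>R imag_unit)"
    by (simp only: re_im_decomp)
  also have "\<dots> = (re_part z * re_part w - im_part z * im_part w) *\<^sub>R 1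
        + (re_part z * im_part w + im_part z * re_part w) *\<^sub>R imag_unit"
    using i by (simp add: algebra_simps)
  finally have zw: "z * w = \<dots>" .
  show ?thesis
    unfolding conjugate_eqI[OF zw] using i
    by (simp add: conjugate_def algebra_simps)
qed

lemma mult_conjugate: "z * conjugate z = of_real ((norm (z :: 'k::real_or_complex))\<^sup>2)"
proof (cases "imag_unit = (0::'k)")
  case True
  then have "of_real (re_part z) = z"
    using re_im_decomp[of z] by (simp add: of_real_def)
  then show ?thesis
    by (metis conjugate_of_real norm_of_real of_real_mult power2_abs power2_eq_square)
next
  case False
  then have i: "imag_unit * imag_unit = (- 1 :: 'k)"
    using imag_unit_cases by auto
  have "z * conjugate z = (re_part z *\<^sub>R 1 + im_part z *\<^sub>R imag_unit) * conjugate z"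
    by (simp only: re_im_decomp)
  also have "\<dots> = of_real ((norm z)\<^sup>2)"
    unfolding norm_re_im using i
    by (simp add: conjugate_def algebra_simps power2_eq_square of_real_def)
  finally show ?thesis .
qed

lemma norm_conjugate [simp]: "norm (conjugate z) = norm (z :: 'k::real_or_complex)"
proof -
  have "of_real ((norm (conjugate z))\<^sup>2) = (of_real ((norm z)\<^sup>2) :: 'k)"
    using mult_conjugate[of z] mult_conjugate[of "conjugate z"] by (simp add: mult.commute)
  then have "(norm (conjugate z))\<^sup>2 = (norm z)\<^sup>2"
    by (simp only: of_real_eq_iff)
  then show ?thesis by simp
qed

context hilbert_space
begin

section \<open>Inner product identities and the Cauchy-Schwarz inequality\<close>

lemma ip_add_right: "ip x (y + z) = ip x y + ip x z"
  by (metis ip_commute ip_add_left conjugate_add)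

lemma ip_smult_right: "ip x (smult c y) = conjugate c * ip x y"
  by (metis ip_commute ip_smult_left conjugate_mult)

lemma ip_scaleR_right: "ip x (r *\<^sub>R y) = of_real r * ip x y"
  by (metis smult_of_real ip_smult_right conjugate_of_real)

lemma ip_diff_left: "ip (x - y) z = ip x z - ip y z"
  using ip_add_left[of "x - y" y z] by simp

lemma ip_diff_right: "ip x (y - z) = ip x y - ip x z"
  using ip_add_right[of x "y - z" z] by simp

lemma ip_zero_right [simp]: "ip x 0 = 0"
  using ip_diff_right[of x 0 0] by simp

lemma ip_self_eq_0 [simp]: "ip x x = 0 \<longleftrightarrow> x = 0"
  by (simp add: ip_self)

lemma norm_smult: "norm (smult c x) = norm c * norm x"
proof -
  have "of_real ((norm (smult c x))\<^sup>2) = c * conjugate c * ip x x"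
    unfolding ip_self[symmetric] by (simp add: ip_smult_left ip_smult_right)
  also have "\<dots> = of_real ((norm c * norm x)\<^sup>2)"
    by (simp add: mult_conjugate ip_self power_mult_distrib)
  finally have "of_real ((norm (smult c x))\<^sup>2) = (of_real ((norm c * norm x)\<^sup>2) :: 'k)" .
  then have "(norm (smult c x))\<^sup>2 = (norm c * norm x)\<^sup>2"
    by (simp only: of_real_eq_iff)
  then show ?thesis by simp
qed

lemma norm_add_square: "(norm (x + y))\<^sup>2 = (norm x)\<^sup>2 + 2 * re_part (ip x y) + (norm y)\<^sup>2"
proof -
  have "of_real ((norm (x + y))\<^sup>2) = ip x x + (ip x y + conjugate (ip x y)) + ip y y"
    unfolding ip_self[symmetric] ip_add_left ip_add_right ip_commute[of x y]
    by (simp add: algebra_simps)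
  also have "\<dots> = of_real ((norm x)\<^sup>2 + 2 * re_part (ip x y) + (norm y)\<^sup>2)"
    by (simp only: add_conjugate ip_self of_real_add)
  finally show ?thesis by (simp only: of_real_eq_iff)
qed

lemma parallelogram: "(norm (x + y :: 'a))\<^sup>2 + (norm (x - y))\<^sup>2 = 2 * (norm x)\<^sup>2 + 2 * (norm y)\<^sup>2"
proof -
  have "of_real ((norm (x + y))\<^sup>2 + (norm (x - y))\<^sup>2) = ip (x + y) (x + y) + ip (x - y) (x - y)"
    by (simp add: ip_self)
  also have "\<dots> = 2 * ip x x + 2 * ip y y"
    by (simp add: ip_add_left ip_add_right ip_diff_left ip_diff_right)
  also have "\<dots> = of_real (2 * (norm x)\<^sup>2 + 2 * (norm y)\<^sup>2)"
    by (simp add: ip_self)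
  finally show ?thesis by (simp only: of_real_eq_iff)
qed

text \<open>Moving \<open>x\<close> against its component along \<open>y\<close>; the choice of \<open>t\<close> gives both the
  Cauchy-Schwarz inequality and the orthogonality of the residual of a closest point.\<close>
lemma norm_diff_component_square:
  "(norm (x - smult (of_real t * ip x y) y))\<^sup>2
    = (norm x)\<^sup>2 - 2 * t * (norm (ip x y))\<^sup>2 + (t * norm (ip x y) * norm y)\<^sup>2"
proof -
  have "ip x (smult (of_real (- t) * ip x y) y) = of_real (- t) * (ip x y * conjugate (ip x y))"
    by (simp only: ip_smult_right conjugate_mult conjugate_of_real mult_ac)
  also have "\<dots> = of_real (- t * (norm (ip x y))\<^sup>2)"
    by (simp only: mult_conjugate of_real_mult)
  finally have "re_part (ip x (smult (of_real (- t) * ip x y) y)) = - t * (norm (ip x y))\<^sup>2"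
    by (simp only: re_part_of_real)
  then show ?thesis
    using norm_add_square[of x "smult (of_real (- t) * ip x y) y"]
    by (simp add: norm_smult norm_mult power_mult_distrib)
qed

lemma Cauchy_Schwarz: "norm (ip x y) \<le> norm x * norm y"
proof (cases "y = 0")
  case False
  \<comment> \<open>With this \<open>t\<close> the subtracted vector is the projection of
    \<open>x\<close> onto the line through \<open>y\<close>, so the residual is as short as
    possible.\<close>
  let ?t = "1 / (norm y)\<^sup>2" and ?p = "norm (ip x y)"
  have "0 \<le> (norm x)\<^sup>2 - 2 * ?t * ?p\<^sup>2 + (?t * ?p * norm y)\<^sup>2"
    unfolding norm_diff_component_square[symmetric] by simp
  also have "\<dots> = (norm x)\<^sup>2 - ?p\<^sup>2 / (norm y)\<^sup>2"
    using False by (simp add: field_simps power2_eq_square)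
  finally have "?p\<^sup>2 \<le> (norm x * norm y)\<^sup>2"
    using False by (simp add: field_simps)
  then show ?thesis by (simp add: power2_le_iff_abs_le)
qed simp

lemma bounded_linear_ip_right: "bounded_linear (ip x)"
  by (rule bounded_linear_intro[of _ "norm x"])
    (simp_all add: ip_add_right ip_scaleR_right scaleR_conv_of_real Cauchy_Schwarz mult.commute[of "norm _" "norm x"])

lemma bounded_linear_smult: "bounded_linear (smult c)"
  by (rule bounded_linear_intro[of _ "norm c"])
    (simp_all add: scale_right_distrib norm_smult mult.commute flip: smult_of_real)

section \<open>Nested closed convex sets and images of bounded ones\<close>

lemma scaleR_mem_subspace: "subspace L \<Longrightarrow> x \<in> L \<Longrightarrow> r *\<^sub>R x \<in> L"
  by (metis smult_of_real subspace_scale)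

lemma convex_subspace: "subspace L \<Longrightarrow> convex L"
  by (simp add: convex_def scaleR_mem_subspace subspace_add)

text \<open>Replaces weak compactness: the elements of almost minimal norm form a Cauchy sequence.\<close>
lemma nested_closed_convex:
  fixes K :: "nat \<Rightarrow> 'a set"
  assumes cl: "\<And>n. closed (K n)" and cv: "\<And>n. convex (K n)" and ne: "\<And>n. K n \<noteq> {}"
    and dec: "decseq K" and bd: "\<And>x. x \<in> K 0 \<Longrightarrow> norm x \<le> b"
  shows "\<exists>x. \<forall>n. x \<in> K n"
proof -
  define d where "d n = Inf (norm ` K n)" for n
  have bb: "bdd_below (norm ` K n)" for n
    by (rule bdd_belowI[of _ 0]) auto
  have d_le: "d n \<le> norm x" if "x \<in> K n" for n x
    unfolding d_def using that bb by (auto intro: cInf_lower)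
  have d_nonneg: "0 \<le> d n" for n
    unfolding d_def using ne by (auto intro: cInf_greatest)
  have "\<exists>y\<in>K n. norm y < d n + inverse (Suc n)" for n
  proof -
    have "Inf (norm ` K n) < d n + inverse (Suc n)" by (simp add: d_def)
    then show ?thesis
      using ne[of n] bb[of n] by (simp add: cInf_less_iff)
  qed
  then obtain y where y: "\<And>n. y n \<in> K n" and y_less: "\<And>n. norm (y n) < d n + inverse (Suc n)"
    by metis
  have inK: "y m \<in> K n" if "n \<le> m" for m n
    using y decseqD[OF dec that] by blast
  \<comment> \<open>Shrinking sets have growing infima, and \<open>b\<close> bounds these, so the
    minimal norms converge.\<close>
  have "incseq d"
    unfolding incseq_def d_def using dec ne bb
    by (auto intro!: cInf_superset_mono dest: decseqD)
  moreover have "d n \<le> b" for n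
    using d_le[OF y] bd[OF inK[of 0 n]] by (rule order_trans) simp
  ultimately obtain D where D: "d \<longlonglongrightarrow> D"
    using incseq_convergent by blast
  have "(\<lambda>n. d n + inverse (Suc n)) \<longlonglongrightarrow> D + 0"
    by (intro tendsto_add D LIMSEQ_inverse_real_of_nat)
  then have D': "(\<lambda>n. d n + inverse (Suc n)) \<longlonglongrightarrow> D" by simp
  have ny: "(\<lambda>n. norm (y n)) \<longlonglongrightarrow> D"
    by (rule tendsto_sandwich[OF _ _ D D'])
      (intro always_eventually allI d_le[OF y] less_imp_le[OF y_less])+
  have "Cauchy y"
  proof (rule CauchyI)
    fix e :: real assume e: "0 < e"
    have "(\<lambda>n. (norm (y n))\<^sup>2) \<longlonglongrightarrow> D\<^sup>2" "(\<lambda>n. (d n)\<^sup>2) \<longlonglongrightarrow> D\<^sup>2"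
      by (intro tendsto_power ny D)+
    \<comment> \<open>The midpoint of \<open>y m\<close> and \<open>y n\<close> lies in
      \<open>K n0\<close>, hence has norm at least \<open>d n0\<close>. In the parallelogram
      identity the margin \<open>e\<^sup>2 / 8\<close> is then used four times for the two norms and
      four times for \<open>d n0\<close>, which adds up to \<open>e\<^sup>2\<close>.\<close>
    then have "\<forall>\<^sub>F n in sequentially. (norm (y n))\<^sup>2 < D\<^sup>2 + e\<^sup>2 / 8 \<and> D\<^sup>2 - e\<^sup>2 / 8 < (d n)\<^sup>2"
      using e by (intro eventually_conj order_tendstoD) auto
    then obtain n0 where n0: "\<And>n. n \<ge> n0 \<Longrightarrow> (norm (y n))\<^sup>2 < D\<^sup>2 + e\<^sup>2 / 8 \<and> D\<^sup>2 - e\<^sup>2 / 8 < (d n)\<^sup>2"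
      by (auto simp: eventually_sequentially)
    show "\<exists>M. \<forall>m\<ge>M. \<forall>n\<ge>M. norm (y m - y n) < e"
    proof (intro exI allI impI)
      fix m n assume mn: "m \<ge> n0" "n \<ge> n0"
      have "(1/2) *\<^sub>R y m + (1/2) *\<^sub>R y n \<in> K n0"
        using cv[of n0] inK mn by (intro convexD) auto
      then have "d n0 \<le> norm ((1/2) *\<^sub>R (y m + y n))"
        by (metis d_le scaleR_add_right)
      then have "2 * d n0 \<le> norm (y m + y n)" by simp
      then have "(2 * d n0)\<^sup>2 \<le> (norm (y m + y n))\<^sup>2"
        using d_nonneg[of n0] by (intro power_mono) auto
      then have "(norm (y m - y n))\<^sup>2 < e\<^sup>2"
        using parallelogram[of "y m" "y n"] n0[OF mn(1)] n0[OF mn(2)] n0[of n0] by simp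
      then show "norm (y m - y n) < e"
        using e by (simp add: power2_less_imp_less)
    qed
  qed
  then obtain x where x: "y \<longlonglongrightarrow> x"
    using Cauchy_convergent_iff convergent_def by blast
  have "x \<in> K n" for n
    by (rule Lim_in_closed_set[OF cl _ _ x]) (auto simp: eventually_sequentially intro: inK)
  then show ?thesis by blast
qed

text \<open>For a limit \<open>z\<close> of image points, the points of \<open>K\<close> that
  \<open>F\<close> maps to within \<open>1/(n+1)\<close> of \<open>z\<close> form nested nonempty
  closed convex bounded sets. A common point of these sets is mapped to \<open>z\<close>
  itself.\<close>

lemma closed_image_bounded_convex:
  assumes F: "bounded_linear F" and K: "closed K" "convex K" "bounded (K :: 'a set)"
  shows "closed (F ` K)"
proof (unfold closed_sequential_limits, intro allI impI, elim conjE)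
  fix s z assume s: "\<forall>n. s n \<in> F ` K" and lim: "s \<longlonglongrightarrow> z"
  interpret F: bounded_linear F by (rule F)
  obtain b where b: "\<And>x. x \<in> K \<Longrightarrow> norm x \<le> b"
    using K(3) by (auto simp: bounded_iff)
  define E where "E n = K \<inter> (F -` cball z (inverse (Suc n)))" for n
  have "closed (E n)" for n
    unfolding E_def using K(1) by (intro closed_Int closed_vimage F.continuous_on) auto
  moreover have "convex (E n)" for n
    unfolding E_def using K(2) F.linear
    by (intro convex_Int convex_linear_vimage convex_cball)
  moreover have "E n \<noteq> {}" for n
  proof -
    obtain m where "dist (s m) z < inverse (Suc n)"
      using metric_LIMSEQ_D[OF lim, of "inverse (Suc n)"] by auto
    moreover obtain x where "x \<in> K" "s m = F x" using s by blast
    ultimately show ?thesis by (force simp: E_def dist_commute)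
  qed
  moreover have "decseq E"
    unfolding decseq_def E_def
  proof (intro allI impI Int_mono order_refl vimage_mono subset_cball)
    fix m n :: nat assume "m \<le> n"
    then show "inverse (real (Suc n)) \<le> inverse (real (Suc m))"
      by (intro le_imp_inverse_le) auto
  qed
  moreover have "norm x \<le> b" if "x \<in> E 0" for x
    using that b by (simp add: E_def)
  ultimately have "\<exists>x. \<forall>n. x \<in> E n"
    by (rule nested_closed_convex)
  then obtain x where x: "\<And>n. x \<in> E n" by blast
  have "dist z (F x) \<le> inverse (Suc n)" for n
    using x[of n] by (simp add: E_def)
  then have "dist z (F x) \<le> 0"
    using LIMSEQ_inverse_real_of_nat by (intro LIMSEQ_le_const) auto
  then show "z \<in> F ` K" using x[of 0] by (auto simp: E_def)
qed

section \<open>Closest points, orthogonal projections and Riesz representation\<close>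

text \<open>The points of \<open>L\<close> whose distance to \<open>x\<close> exceeds the infimum by
  at most \<open>1/(n+1)\<close> are again nested closed convex sets; a common point attains the
  infimum.\<close>

lemma closest_point_subspace:
  assumes L: "closed_subspace L"
  obtains y where "y \<in> L" and "\<And>w. w \<in> L \<Longrightarrow> norm (x - y) \<le> norm (x - w)"
proof -
  have sL: "subspace L" and cL: "closed L" using L by (auto simp: closed_subspace_def)
  have neL: "L \<noteq> {}" using subspace_0[OF sL] by blast
  define d where "d = infdist x L"
  define K where "K n = L \<inter> cball x (d + inverse (Suc n))" for n
  have "closed (K n)" "convex (K n)" for n
    unfolding K_def using cL convex_subspace[OF sL] by (auto intro: convex_Int)
  moreover have "K n \<noteq> {}" for n
  proof -
    have "infdist x L < d + inverse (Suc n)" by (simp add: d_def)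
    then obtain y where "y \<in> L" "dist x y < d + inverse (Suc n)"
      using neL by (auto simp: infdist_def cInf_less_iff)
    then show ?thesis by (force simp: K_def)
  qed
  moreover have "decseq K"
    unfolding decseq_def K_def
  proof (intro allI impI Int_mono order_refl subset_cball add_left_mono)
    fix m n :: nat assume "m \<le> n"
    then show "inverse (real (Suc n)) \<le> inverse (real (Suc m))"
      by (intro le_imp_inverse_le) auto
  qed
  moreover have "norm y \<le> norm x + (d + 1)" if "y \<in> K 0" for y
    using that norm_triangle_ineq2[of y x] by (simp add: K_def dist_norm norm_minus_commute)
  ultimately have "\<exists>y. \<forall>n. y \<in> K n"
    by (rule nested_closed_convex)
  then obtain y where y: "\<And>n. y \<in> K n" by blast
  have "dist x y \<le> d + inverse (Suc n)" for n
    using y[of n] by (simp add: K_def)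
  moreover have "(\<lambda>n. d + inverse (Suc n)) \<longlonglongrightarrow> d + 0"
    by (intro tendsto_add tendsto_const LIMSEQ_inverse_real_of_nat)
  ultimately have "dist x y \<le> d"
    by (intro LIMSEQ_le_const) auto
  then have "norm (x - y) \<le> norm (x - w)" if "w \<in> L" for w
    using infdist_le[OF that, of x] by (simp add: d_def dist_norm)
  moreover have "y \<in> L" using y[of 0] by (simp add: K_def)
  ultimately show thesis by (rule that[rotated])
qed

text \<open>The closest point works: if the residual were not orthogonal to some \<open>w\<close> in
  \<open>L\<close>, a small move along \<open>w\<close> would bring the point closer to
  \<open>x\<close>.\<close>

lemma ex_proj:
  assumes L: "closed_subspace L"
  shows "\<exists>y. y \<in> L \<and> x - y \<in> orth L"
proof -
  obtain y where y: "y \<in> L" and min: "\<And>w. w \<in> L \<Longrightarrow> norm (x - y) \<le> norm (x - w)"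
    using closest_point_subspace[OF L] by blast
  have sL: "subspace L" using L by (auto simp: closed_subspace_def)
  have "ip w (x - y) = 0" if w: "w \<in> L" for w
  proof (rule ccontr)
    assume nz: "ip w (x - y) \<noteq> 0"
    define u where "u = x - y"
    define p where "p = norm (ip u w)"
    have p: "0 < p"
      using nz ip_commute[of u w] by (auto simp: p_def u_def)
    define a where "a = (norm w)\<^sup>2"
    \<comment> \<open>Any positive \<open>t\<close> with \<open>t * a < 2\<close> shortens the
      residual; the summand 1 keeps the denominator positive without an argument that
      \<open>w\<close> is nonzero.\<close>
    define t where "t = 1 / (1 + a)"
    have a: "0 \<le> a" and t: "0 < t" "t * a < 1" by (auto simp: a_def t_def field_simps add_pos_nonneg)
    have "norm u \<le> norm (x - (y + smult (of_real t * ip u w) w))"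
      unfolding u_def by (intro min subspace_add[OF sL] y subspace_scale[OF sL] w)
    then have "(norm u)\<^sup>2 \<le> (norm (u - smult (of_real t * ip u w) w))\<^sup>2"
      by (simp add: u_def algebra_simps)
    also have "\<dots> = (norm u)\<^sup>2 - t * p\<^sup>2 * (2 - t * a)"
      unfolding norm_diff_component_square p_def a_def by (simp add: power2_eq_square algebra_simps)
    finally show False
      using p t by (simp add: mult_le_0_iff)
  qed
  then show ?thesis using y by (auto simp: orth_def)
qed

lemma proj_eqI:
  assumes "closed_subspace L" "y \<in> L" "x - y \<in> orth L"
  shows "proj L x = y"
  unfolding proj_def
proof (rule the_equality)
  fix z assume z: "z \<in> L \<and> x - z \<in> orth L"
  have "y - z \<in> L"
    using assms z by (auto simp: closed_subspace_def intro: subspace_diff)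
  then have "ip (y - z) (x - z) = 0" "ip (y - z) (x - y) = 0"
    using assms z by (auto simp: orth_def)
  then have "ip (y - z) (y - z) = 0" by (simp add: ip_diff_right)
  then show "z = y" by simp
qed (use assms in auto)

lemma proj_mem: "closed_subspace L \<Longrightarrow> proj L x \<in> L"
  and diff_proj_mem_orth: "closed_subspace L \<Longrightarrow> x - proj L x \<in> orth L"
  using ex_proj[of L x] proj_eqI[of L _ x] by auto

lemma closed_subspace_orth: "closed_subspace (orth L)"
  unfolding closed_subspace_def
proof
  show "subspace (orth L)"
    by (auto simp: orth_def subspace_def ip_add_right ip_smult_right)
  have "orth L = (\<Inter>x\<in>L. ip x -` {0})" by (auto simp: orth_def)
  moreover have "closed \<dots>"
    by (intro closed_INT ballI closed_vimage closed_singleton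
        linear_continuous_on bounded_linear_ip_right)
  ultimately show "closed (orth L)" by simp
qed

lemma proj_orth: "closed_subspace L \<Longrightarrow> proj (orth L) x = x - proj L x"
proof (rule proj_eqI[OF closed_subspace_orth diff_proj_mem_orth])
  assume L: "closed_subspace L"
  have "ip w (proj L x) = 0" if "w \<in> orth L" for w
    using that proj_mem[OF L, of x] ip_commute[of w "proj L x"] by (simp add: orth_def)
  then show "x - (x - proj L x) \<in> orth (orth L)" by (simp add: orth_def)
qed

lemma proj_scaleR: "closed_subspace L \<Longrightarrow> proj L (r *\<^sub>R x) = r *\<^sub>R proj L x"
  by (rule proj_eqI)
    (use proj_mem[of L x] diff_proj_mem_orth[of L x] closed_subspace_orth[of L] in
      \<open>auto simp: closed_subspace_def scaleR_mem_subspace simp flip: scaleR_diff_right\<close>)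

lemma ip_proj_left:
  assumes L: "closed_subspace L" and z: "z \<in> L"
  shows "ip (proj L x) z = ip x z"
proof -
  have "ip z (x - proj L x) = 0"
    using diff_proj_mem_orth[OF L] z by (simp add: orth_def)
  then have "ip (x - proj L x) z = 0" using ip_commute[of "x - proj L x" z] by simp
  then show ?thesis by (simp add: ip_diff_left)
qed

lemma ip_proj_right: "closed_subspace L \<Longrightarrow> z \<in> L \<Longrightarrow> ip z (proj L x) = ip z x"
  by (metis ip_commute ip_proj_left)

text \<open>The kernel \<open>K\<close> of \<open>f\<close> is closed. A vector \<open>u\<close>
  orthogonal to \<open>K\<close> with \<open>f u\<close> nonzero spans a complement, since
  \<open>x - (f x / f u) u\<close> lies in \<open>K\<close>; so \<open>f\<close> is a multiple of
  \<open>ip _ u\<close>.\<close>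

lemma Riesz_representation:
  assumes add: "\<And>x y. f (x + y) = f x + f y" and scale: "\<And>c x. f (smult c x) = c * f x"
    and bound: "\<And>x. norm (f x) \<le> b * norm x"
  obtains y where "\<And>x. f x = ip x y"
proof (cases "\<forall>x. f x = 0")
  case True
  then show thesis using that[of 0] by simp
next
  case False
  then obtain x0 where x0: "f x0 \<noteq> 0" by blast
  define K where "K = f -` {0}"
  have diff: "f (x - y) = f x - f y" for x y using add[of "x - y" y] by simp
  have "bounded_linear f"
    by (rule bounded_linear_intro[of _ b])
      (simp_all add: add bound mult.commute scale scaleR_conv_of_real flip: smult_of_real)
  then have "closed K"
    unfolding K_def by (intro closed_vimage closed_singleton linear_continuous_on)
  moreover have "subspace K"
    using diff[of 0 0] by (auto simp: K_def subspace_def add scale)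
  ultimately have K: "closed_subspace K" by (simp add: closed_subspace_def)
  define u where "u = x0 - proj K x0"
  have u: "u \<in> orth K" unfolding u_def by (rule diff_proj_mem_orth[OF K])
  have fu: "f u \<noteq> 0"
    using x0 proj_mem[OF K, of x0] by (simp add: u_def diff K_def)
  then have nu: "norm u \<noteq> 0" using diff[of 0 0] by auto
  \<comment> \<open>The representing vector is scaled by \<open>conjugate c\<close>, because
    \<open>ip\<close> is conjugate-linear in its second argument.\<close>
  define c where "c = f u / of_real ((norm u)\<^sup>2)"
  have "f x = ip x (smult (conjugate c) u)" for x
  proof -
    have "x - smult (f x / f u) u \<in> K" using fu by (simp add: K_def diff scale)
    then have "ip (x - smult (f x / f u) u) u = 0" using u by (auto simp: orth_def)
    then have "ip x u = f x / f u * of_real ((norm u)\<^sup>2)"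
      by (simp add: ip_diff_left ip_smult_left ip_self)
    then show ?thesis using fu nu by (simp add: ip_smult_right c_def)
  qed
  then show thesis by (rule that)
qed

section \<open>Bounded operators linear over the scalar field\<close>

lemma bounded_ops_smult: "T \<in> bounded_ops \<Longrightarrow> blinfun_apply T (smult c x) = smult c (blinfun_apply T x)"
  by (simp add: bounded_ops_def Vector_Spaces.linear_iff)

lemma bounded_opsI:
  "(\<And>c x. blinfun_apply T (smult c x) = smult c (blinfun_apply T x)) \<Longrightarrow> T \<in> bounded_ops"
  by (simp add: bounded_ops_def Vector_Spaces.linear_iff blinfun.add_right vector_space_axioms)

text \<open>\<open>Blinfun\<close> is meaningful only on bounded linear maps; this obligation is
  discharged here once for all scalar multiples.\<close>

lemma op_scale_apply [simp]: "blinfun_apply (op_scale c T) x = smult c (blinfun_apply T x)"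
  unfolding op_scale_def
  by (subst bounded_linear_Blinfun_apply)
    (simp_all add: bounded_linear_compose[OF bounded_linear_smult] blinfun.bounded_linear_right)

lemma norm_op_scale_le: "norm (op_scale c T) \<le> norm c * norm T"
  by (rule norm_blinfun_bound)
    (auto simp: norm_smult mult.assoc intro!: mult_left_mono norm_blinfun)

lemma bounded_ops_compose: "R \<in> bounded_ops \<Longrightarrow> S \<in> bounded_ops \<Longrightarrow> R o\<^sub>L S \<in> bounded_ops"
  by (rule bounded_opsI) (simp add: bounded_ops_smult)

lemma bounded_ops_op_scale: "T \<in> bounded_ops \<Longrightarrow> op_scale c T \<in> bounded_ops"
  by (rule bounded_opsI) (simp add: bounded_ops_smult scale_left_commute)

lemma bounded_ops_op_power: "T \<in> bounded_ops \<Longrightarrow> op_power T n \<in> bounded_ops"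
  by (induction n) (simp_all add: bounded_ops_compose bounded_opsI)

lemma bounded_ops_sum: "(\<And>i. i \<in> I \<Longrightarrow> S i \<in> bounded_ops) \<Longrightarrow> sum S I \<in> bounded_ops"
  by (rule bounded_opsI) (simp add: blinfun.sum_left bounded_ops_smult scale_sum_right)

lemma bounded_ops_limit:
  assumes "\<And>n. S n \<in> bounded_ops" and lim: "S \<longlonglongrightarrow> T"
  shows "T \<in> bounded_ops"
proof (rule bounded_opsI)
  fix c x
  have "(\<lambda>n. smult c (blinfun_apply (S n) x)) \<longlonglongrightarrow> smult c (blinfun_apply T x)"
    by (intro bounded_linear.tendsto[OF bounded_linear_smult] blinfun.tendsto lim tendsto_const)
  moreover have "(\<lambda>n. blinfun_apply (S n) (smult c x)) \<longlonglongrightarrow> blinfun_apply T (smult c x)"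
    by (intro blinfun.tendsto lim tendsto_const)
  ultimately show "blinfun_apply T (smult c x) = smult c (blinfun_apply T x)"
    using assms(1) by (simp add: bounded_ops_smult LIMSEQ_unique)
qed

section \<open>Adjoints of operators and of their blocks\<close>

abbreviation op_adj :: "('a \<Rightarrow>\<^sub>L 'a) \<Rightarrow> 'a \<Rightarrow> 'a" where
  "op_adj T \<equiv> adj UNIV (blinfun_apply T)"

text \<open>Two candidates for the adjoint value differ by a vector of \<open>L\<close> that is
  orthogonal to all of \<open>L\<close>, hence to itself.\<close>

lemma adj_eqI:
  assumes L: "subspace L" and y: "y \<in> L" "\<And>x. x \<in> L \<Longrightarrow> ip (F x) z = ip x y"
  shows "adj L F z = y"
  unfolding adj_def
proof (rule the_equality)
  fix w assume w: "w \<in> L \<and> (\<forall>x\<in>L. ip (F x) z = ip x w)"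
  then have "w - y \<in> L" using L y by (auto intro: subspace_diff)
  then have "ip (w - y) (w - y) = 0" using w y(2) by (simp only: ip_diff_right) auto
  then show "w = y" by simp
qed (use y in auto)

lemma ip_op_adj:
  assumes T: "T \<in> bounded_ops"
  shows "ip (blinfun_apply T x) z = ip x (op_adj T z)"
proof -
  have "norm (ip (blinfun_apply T x) z) \<le> (norm T * norm z) * norm x" for x
  proof -
    have "norm (ip (blinfun_apply T x) z) \<le> norm (blinfun_apply T x) * norm z"
      by (rule Cauchy_Schwarz)
    also have "\<dots> \<le> (norm T * norm x) * norm z"
      by (intro mult_right_mono norm_blinfun) simp
    finally show ?thesis by (simp add: mult_ac)
  qed
  then obtain y where y: "\<And>x. ip (blinfun_apply T x) z = ip x y"
    using Riesz_representation[of "\<lambda>x. ip (blinfun_apply T x) z"]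
    by (auto simp: blinfun.add_right ip_add_left bounded_ops_smult[OF T] ip_smult_left)
  moreover from y have "op_adj T z = y"
    by (intro adj_eqI) auto
  ultimately show ?thesis by simp
qed

lemma op_adj_eqI: "(\<And>x. ip (blinfun_apply T x) z = ip x y) \<Longrightarrow> op_adj T z = y"
  by (rule adj_eqI) auto

text \<open>Moving one adjoint across the inner product gives \<open>ip y y = ip (T y) z\<close> for
  \<open>y = op_adj T z\<close>; Cauchy-Schwarz follows, and one factor \<open>norm y\<close>
  cancels.\<close>

lemma norm_op_adj_le:
  assumes T: "T \<in> bounded_ops"
  shows "norm (op_adj T z) \<le> norm T * norm z"
proof -
  let ?y = "op_adj T z"
  have "(norm ?y)\<^sup>2 = norm (ip ?y ?y)" by (simp add: ip_self norm_power)
  also have "\<dots> = norm (ip (blinfun_apply T ?y) z)" by (simp add: ip_op_adj[OF T])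
  also have "\<dots> \<le> norm (blinfun_apply T ?y) * norm z" by (rule Cauchy_Schwarz)
  also have "\<dots> \<le> (norm T * norm ?y) * norm z" by (intro mult_right_mono norm_blinfun) simp
  finally have "norm ?y * norm ?y \<le> norm ?y * (norm T * norm z)"
    by (simp add: power2_eq_square mult_ac)
  then show ?thesis
    by (cases "norm ?y = 0") (auto simp: mult_le_cancel_left)
qed

lemma bounded_linear_op_adj:
  assumes T: "T \<in> bounded_ops"
  shows "bounded_linear (op_adj T)"
proof (rule bounded_linear_intro[of _ "norm T"])
  show "op_adj T (x + y) = op_adj T x + op_adj T y" for x y
    by (rule op_adj_eqI) (simp add: ip_add_right ip_op_adj[OF T])
  show "op_adj T (r *\<^sub>R x) = r *\<^sub>R op_adj T x" for r x
    by (rule op_adj_eqI) (simp add: ip_scaleR_right ip_op_adj[OF T])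
  show "norm (op_adj T x) \<le> norm x * norm T" for x
    using norm_op_adj_le[OF T, of x] by (simp add: mult.commute)
qed

lemma op_adj_diff:
  "S \<in> bounded_ops \<Longrightarrow> T \<in> bounded_ops \<Longrightarrow> op_adj (S - T) z = op_adj S z - op_adj T z"
  by (rule op_adj_eqI) (simp add: blinfun.diff_left ip_diff_left ip_diff_right ip_op_adj)

lemma op_adj_compose:
  "R \<in> bounded_ops \<Longrightarrow> S \<in> bounded_ops \<Longrightarrow> op_adj (R o\<^sub>L S) z = op_adj S (op_adj R z)"
  by (rule op_adj_eqI) (simp add: ip_op_adj)

lemma adj_block:
  assumes "closed_subspace L" "closed_subspace L'" "T \<in> bounded_ops" "z \<in> L'"
  shows "adj L (block L L' (blinfun_apply T)) z = proj L (op_adj T z)"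
  by (rule adj_eqI)
    (use assms in \<open>auto simp: closed_subspace_def[of L] proj_mem block_def ip_proj_left ip_proj_right ip_op_adj\<close>)

section \<open>Domination of one unit ball image by the complementary one\<close>

text \<open>The same map \<open>F\<close> acts on both balls, which is what makes the relation
  stable under composition from the left.\<close>

definition ball_dominated :: "real \<Rightarrow> 'a set \<Rightarrow> ('a \<Rightarrow> 'a) \<Rightarrow> bool" where
  "ball_dominated lam L F \<longleftrightarrow>
    (\<forall>x\<in>unit_ball L. \<exists>y\<in>unit_ball (orth L). F x = lam *\<^sub>R F y)"

lemma ball_dominated_image_iff:
  "F ` unit_ball L \<subseteq> (\<lambda>z. lam *\<^sub>R z) ` F ` unit_ball (orth L) \<longleftrightarrow> ball_dominated lam L F"
  by (simp add: ball_dominated_def image_image image_subset_iff image_iff)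

text \<open>The vector \<open>y\<close> chosen for \<open>F\<close> also serves for the composition,
  as \<open>G\<close> respects scaling by \<open>lam\<close>.\<close>

lemma ball_dominated_comp:
  assumes "ball_dominated lam L F" and "\<And>x. G (lam *\<^sub>R x) = lam *\<^sub>R G x"
  shows "ball_dominated lam L (\<lambda>x. G (F x))"
  using assms unfolding ball_dominated_def by metis

text \<open>The set of all \<open>lam *\<^sub>R G y\<close> with \<open>y\<close> in the
  complementary unit ball is closed, so it is enough to approximate \<open>G x\<close> from it. A
  vector \<open>y\<close> that serves for \<open>F n\<close> gives an error of at most
  \<open>(1 + \<bar>lam\<bar>) * e n\<close>.\<close>

lemma ball_dominated_limit:
  assumes F: "\<And>n. ball_dominated lam L (F n)" and G: "bounded_linear G"
    and diff: "\<And>n x. norm (F n x - G x) \<le> e n * norm x"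
    and e_nonneg: "\<And>n. 0 \<le> e n" and e: "e \<longlonglongrightarrow> 0"
  shows "ball_dominated lam L G"
  unfolding ball_dominated_def
proof
  fix x assume x: "x \<in> unit_ball L"
  interpret G: bounded_linear G by (rule G)
  let ?K = "unit_ball (orth L)"
  have K: "?K = orth L \<inter> cball 0 1"
    by (auto simp: unit_ball_def)
  have "closed ((\<lambda>y. lam *\<^sub>R G y) ` ?K)"
    using closed_subspace_orth[of L] unfolding K closed_subspace_def
    by (intro closed_image_bounded_convex bounded_linear_compose[OF bounded_linear_scaleR_right G])
      (auto intro: convex_Int convex_subspace bounded_subset)
  moreover have "\<exists>z\<in>(\<lambda>y. lam *\<^sub>R G y) ` ?K. dist z (G x) < r" if r: "0 < r" for r
  proof -
    have "\<forall>\<^sub>F n in sequentially. e n < r / (1 + \<bar>lam\<bar>)"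
      using r by (intro order_tendstoD[OF e]) (simp add: add_pos_nonneg)
    then obtain n where n: "e n < r / (1 + \<bar>lam\<bar>)"
      by (meson eventually_sequentially order_refl)
    obtain y where y: "y \<in> ?K" "F n x = lam *\<^sub>R F n y"
      using F[of n] x unfolding ball_dominated_def by blast
    have le: "norm (F n w - G w) \<le> e n" if "norm w \<le> 1" for w
      using diff[of n w] mult_left_mono[OF that e_nonneg[of n]] by simp
    have "lam *\<^sub>R G y - G x = (F n x - G x) - lam *\<^sub>R (F n y - G y)"
      by (simp add: y(2) scaleR_diff_right)
    then have "dist (lam *\<^sub>R G y) (G x) \<le> norm (F n x - G x) + \<bar>lam\<bar> * norm (F n y - G y)"
      unfolding dist_norm by (metis norm_triangle_ineq4 norm_scaleR)
    also have "\<dots> \<le> e n + \<bar>lam\<bar> * e n"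
      using x y(1) by (intro add_mono mult_left_mono le) (auto simp: unit_ball_def)
    also have "\<dots> < r" using n by (simp add: field_simps)
    finally show ?thesis using y(1) by blast
  qed
  ultimately have "G x \<in> (\<lambda>y. lam *\<^sub>R G y) ` ?K"
    using closed_approachable by blast
  then show "\<exists>y\<in>?K. G x = lam *\<^sub>R G y" by blast
qed

section \<open>The classes \<open>phi\<close> and \<open>psi\<close>\<close>

text \<open>The projections onto \<open>N\<close> and \<open>orth N\<close> add up to the identity,
  so \<open>A + C\<close> and \<open>B + D\<close> are the restrictions of \<open>T\<close> to
  \<open>M\<close> and \<open>orth M\<close>. Splitting along \<open>M\<close> does the same for the
  adjoint on \<open>N\<close> and \<open>orth N\<close>.\<close>

lemma phi_iff:
  assumes M: "closed_subspace M" and N: "closed_subspace N"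
  shows "T \<in> phi M N lam \<longleftrightarrow>
    T \<in> bounded_ops \<and> ball_dominated lam M (blinfun_apply T) \<and> ball_dominated lam N (op_adj T)"
proof (cases "T \<in> bounded_ops")
  case T: True
  have orthM: "closed_subspace (orth M)" and orthN: "closed_subspace (orth N)"
    by (rule closed_subspace_orth)+
  let ?A = "block M N (blinfun_apply T)" and ?B = "block (orth M) N (blinfun_apply T)"
    and ?C = "block M (orth N) (blinfun_apply T)" and ?D = "block (orth M) (orth N) (blinfun_apply T)"
  have "(\<lambda>x. ?A x + ?C x) ` unit_ball M = blinfun_apply T ` unit_ball M"
    "(\<lambda>x. ?B x + ?D x) ` unit_ball (orth M) = blinfun_apply T ` unit_ball (orth M)"
    by (intro image_cong refl; simp add: block_def unit_ball_def proj_orth[OF N])+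
  moreover have "(\<lambda>z. adj M ?A z + adj (orth M) ?B z) ` unit_ball N = op_adj T ` unit_ball N"
    "(\<lambda>z. adj M ?C z + adj (orth M) ?D z) ` unit_ball (orth N) = op_adj T ` unit_ball (orth N)"
    by (intro image_cong refl;
        simp add: unit_ball_def adj_block[OF M _ T] adj_block[OF orthM _ T] N orthN proj_orth[OF M])+
  ultimately show ?thesis
    using T by (simp add: phi_def ball_dominated_image_iff)
qed (simp add: phi_def)

text \<open>Projecting \<open>T\<close> to \<open>orth N\<close> turns its restrictions to
  \<open>M\<close> and \<open>orth M\<close> into \<open>C\<close> and \<open>D\<close>. Projecting
  the adjoint to \<open>orth M\<close> leaves the adjoints of \<open>B\<close> and
  \<open>D\<close>.\<close>

lemma phi_subset_psi:
  assumes M: "closed_subspace M" and N: "closed_subspace N"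
  shows "phi M N lam \<subseteq> psi M N lam"
proof
  fix T assume "T \<in> phi M N lam"
  then have T: "T \<in> bounded_ops" and d: "ball_dominated lam M (blinfun_apply T)"
    "ball_dominated lam N (op_adj T)"
    by (simp_all add: phi_iff[OF M N])
  have orthM: "closed_subspace (orth M)" and orthN: "closed_subspace (orth N)"
    by (rule closed_subspace_orth)+
  have d': "ball_dominated lam M (\<lambda>x. proj (orth N) (blinfun_apply T x))"
    "ball_dominated lam N (\<lambda>z. proj (orth M) (op_adj T z))"
    by (rule ball_dominated_comp[OF d(1)] ball_dominated_comp[OF d(2)],
        intro proj_scaleR orthM orthN)+
  have "block M (orth N) (blinfun_apply T) ` unit_ball M
      = (\<lambda>x. proj (orth N) (blinfun_apply T x)) ` unit_ball M"
    "block (orth M) (orth N) (blinfun_apply T) ` unit_ball (orth M)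
      = (\<lambda>x. proj (orth N) (blinfun_apply T x)) ` unit_ball (orth M)"
    by (intro image_cong refl; simp add: block_def unit_ball_def)+
  moreover have "adj (orth M) (block (orth M) N (blinfun_apply T)) ` unit_ball N
      = (\<lambda>z. proj (orth M) (op_adj T z)) ` unit_ball N"
    "adj (orth M) (block (orth M) (orth N) (blinfun_apply T)) ` unit_ball (orth N)
      = (\<lambda>z. proj (orth M) (op_adj T z)) ` unit_ball (orth N)"
    by (intro image_cong refl; simp add: unit_ball_def adj_block[OF orthM _ T] N orthN)+
  ultimately show "T \<in> psi M N lam"
    using T d' by (simp add: psi_def flip: ball_dominated_image_iff)
qed

lemma phi_limit:
  assumes M: "closed_subspace M" and N: "closed_subspace N"
    and S: "\<And>n. S n \<in> phi M N lam" and lim: "S \<longlonglongrightarrow> T"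
  shows "T \<in> phi M N lam"
proof -
  have Sb: "S n \<in> bounded_ops" and d: "ball_dominated lam M (blinfun_apply (S n))"
    "ball_dominated lam N (op_adj (S n))" for n
    using S by (simp_all add: phi_iff[OF M N])
  have T: "T \<in> bounded_ops" using Sb lim by (rule bounded_ops_limit)
  have diff: "S n - T \<in> bounded_ops" for n
    by (rule bounded_opsI) (simp add: blinfun.diff_left bounded_ops_smult[OF Sb] bounded_ops_smult[OF T] scale_right_diff_distrib)
  \<comment> \<open>Passing to adjoints does not increase the norm, so this one null sequence
    controls both inclusions.\<close>
  have e: "(\<lambda>n. norm (S n - T)) \<longlonglongrightarrow> 0"
    using lim by (simp add: LIM_zero_iff tendsto_norm_zero)
  have "ball_dominated lam M (blinfun_apply T)"
    by (rule ball_dominated_limit[where F = "\<lambda>n. blinfun_apply (S n)", OF d(1) _ _ norm_ge_zero e])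
      (simp_all add: blinfun.bounded_linear_right norm_blinfun flip: blinfun.diff_left)
  moreover have "ball_dominated lam N (op_adj T)"
    by (rule ball_dominated_limit[where F = "\<lambda>n. op_adj (S n)", OF d(2) _ _ norm_ge_zero e])
      (simp_all add: bounded_linear_op_adj[OF T] norm_op_adj_le diff flip: op_adj_diff[OF Sb T])
  ultimately show ?thesis using T by (simp add: phi_iff[OF M N])
qed

text \<open>The adjoint of \<open>R o\<^sub>L T\<close> has the adjoint of \<open>R\<close> on the
  inside. Commutation rewrites the operator as \<open>T o\<^sub>L R\<close>, whose adjoint applies
  that of \<open>R\<close> last, so both inclusions come from composition from the left.\<close>

lemma phi_compose:
  assumes M: "closed_subspace M" and N: "closed_subspace N" and T: "T \<in> phi M N lam"
    and R: "R \<in> bounded_ops" and comm: "R o\<^sub>L T = T o\<^sub>L R"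
  shows "R o\<^sub>L T \<in> phi M N lam"
proof -
  have Tb: "T \<in> bounded_ops" and d: "ball_dominated lam M (blinfun_apply T)"
    "ball_dominated lam N (op_adj T)"
    using T by (simp_all add: phi_iff[OF M N])
  have "ball_dominated lam M (\<lambda>x. blinfun_apply R (blinfun_apply T x))"
    by (rule ball_dominated_comp[OF d(1)]) (simp add: blinfun.scaleR_right)
  then have "ball_dominated lam M (blinfun_apply (R o\<^sub>L T))"
    by (simp add: ball_dominated_def)
  moreover have "ball_dominated lam N (\<lambda>z. op_adj R (op_adj T z))"
    by (rule ball_dominated_comp[OF d(2)]) (intro linear_cmul bounded_linear.linear bounded_linear_op_adj R)
  then have "ball_dominated lam N (op_adj (R o\<^sub>L T))"
    by (simp add: ball_dominated_def comm op_adj_compose R Tb)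
  ultimately show ?thesis
    by (simp add: phi_iff[OF M N] bounded_ops_compose R Tb)
qed

section \<open>Powers, polynomials and power series of an operator\<close>

lemma op_power_commute:
  "blinfun_apply (op_power T n) (blinfun_apply T x) = blinfun_apply T (blinfun_apply (op_power T n) x)"
  by (induction n) simp_all

lemma norm_op_power_le: "norm (op_power T n) \<le> norm T ^ n"
proof (induction n)
  case 0
  show ?case by (simp add: norm_blinfun_id_le)
next
  case (Suc n)
  have "norm (T o\<^sub>L op_power T n) \<le> norm T * norm (op_power T n)"
    by (rule norm_blinfun_compose)
  also have "\<dots> \<le> norm T * norm T ^ n" by (intro mult_left_mono Suc) simp
  finally show ?case by simp
qed

text \<open>A polynomial in \<open>T\<close> without constant term factors as
  \<open>R o\<^sub>L T\<close>, where \<open>R\<close> is again a polynomial in \<open>T\<close> and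
  so commutes with it. Single powers and partial sums are both instances.\<close>

lemma phi_power_sum:
  assumes M: "closed_subspace M" and N: "closed_subspace N" and T: "T \<in> phi M N lam"
  shows "(\<Sum>i\<in>I. op_scale (c i) (op_power T (Suc i))) \<in> phi M N lam"
proof -
  have Tb: "T \<in> bounded_ops" using T by (simp add: phi_iff[OF M N])
  define R where "R = (\<Sum>i\<in>I. op_scale (c i) (op_power T i))"
  have *: "(\<Sum>i\<in>I. op_scale (c i) (op_power T (Suc i))) = R o\<^sub>L T"
    by (rule blinfun_eqI) (simp add: R_def blinfun.sum_left op_power_commute)
  have "R o\<^sub>L T = T o\<^sub>L R"
    by (rule blinfun_eqI) (simp add: R_def blinfun.sum_left blinfun.sum_right op_power_commute bounded_ops_smult[OF Tb])
  moreover have "R \<in> bounded_ops"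
    unfolding R_def by (intro bounded_ops_sum bounded_ops_op_scale bounded_ops_op_power Tb)
  ultimately show ?thesis
    unfolding * by (intro phi_compose M N T)
qed

lemma phi_op_scale_power:
  "closed_subspace M \<Longrightarrow> closed_subspace N \<Longrightarrow> T \<in> phi M N lam \<Longrightarrow>
    op_scale c (op_power T (Suc n)) \<in> phi M N lam"
  using phi_power_sum[of M N T lam "\<lambda>_. c" "{n}"] by simp

text \<open>The norm of the term of degree \<open>n\<close> is at most the \<open>n\<close>-th power
  of \<open>root n (norm (c n)) * norm T\<close>, hence at most \<open>\<beta> ^ n\<close>; the
  geometric series dominates.\<close>

lemma summable_op_power_series:
  assumes \<beta>: "\<beta> < 1" and le: "\<And>n. n \<ge> 1 \<Longrightarrow> root n (norm (c n)) * norm T \<le> \<beta>"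
  shows "summable (\<lambda>n. op_scale (c (Suc n)) (op_power T (Suc n)))"
proof (rule summable_comparison_test')
  \<comment> \<open>The bound at \<open>n = 1\<close> forces \<open>\<beta>\<close> to be
    nonnegative, which together with \<open>\<beta> < 1\<close> makes the geometric series
    converge.\<close>
  have "0 \<le> root 1 (norm (c 1)) * norm T" by simp
  then have \<beta>0: "0 \<le> \<beta>" using le[of 1] by linarith
  show "summable (\<lambda>n. \<beta> ^ Suc n)"
    using \<beta> \<beta>0 by (subst summable_Suc_iff) (simp add: summable_geometric)
  fix n
  have "norm (op_scale (c (Suc n)) (op_power T (Suc n))) \<le> norm (c (Suc n)) * norm (op_power T (Suc n))"
    by (rule norm_op_scale_le)
  also have "\<dots> \<le> norm (c (Suc n)) * norm T ^ Suc n"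
    by (intro mult_left_mono norm_op_power_le) simp
  also have "\<dots> = (root (Suc n) (norm (c (Suc n))) * norm T) ^ Suc n"
    unfolding power_mult_distrib by (subst real_root_pow_pos2) simp_all
  also have "\<dots> \<le> \<beta> ^ Suc n"
    by (intro power_mono le mult_nonneg_nonneg real_root_ge_zero) simp_all
  finally show "norm (op_scale (c (Suc n)) (op_power T (Suc n))) \<le> \<beta> ^ Suc n" .
qed

end

theorem theorem3p11:
  fixes smult :: "'k::real_or_complex \<Rightarrow> 'a::banach \<Rightarrow> 'a"
    and ip :: "'a \<Rightarrow> 'a \<Rightarrow> 'k"
    and M N :: "'a set"
    and lam :: real
    and T :: "'a \<Rightarrow>\<^sub>L 'a"
    and \<alpha> :: "nat \<Rightarrow> 'k"
  assumes "hilbert_space smult ip"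
    and "hilbert_space.closed_subspace smult M"
    and "hilbert_space.closed_subspace smult N"
    and "lam > 0"
    and "T \<in> hilbert_space.phi smult ip M N lam"
  shows
    "((\<forall>n\<ge>1. hilbert_space.op_scale smult (\<alpha> n) (op_power T n)
          \<in> hilbert_space.phi smult ip M N lam) \<and>
      (\<forall>T' \<in> hilbert_space.bounded_ops smult.
         (\<lambda>n. hilbert_space.op_scale smult (\<alpha> n) (op_power T n)) \<longlonglongrightarrow> T' \<longrightarrow>
         blinfun_apply T' \<in> hilbert_space.closed_range_D smult ip M N \<longrightarrow>
         T' \<in> hilbert_space.psi smult ip M N lam))
     \<and>
     (\<forall>n\<ge>1. (\<Sum>i=1..n. hilbert_space.op_scale smult (\<alpha> i) (op_power T i))
          \<in> hilbert_space.psi smult ip M N lam)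
     \<and>
     ((\<exists>\<beta><1. \<forall>n\<ge>1. root n (norm (\<alpha> n)) * norm T \<le> \<beta>) \<longrightarrow>
      (\<exists>S \<in> hilbert_space.bounded_ops smult.
         (\<lambda>n. hilbert_space.op_scale smult (\<alpha> (Suc n)) (op_power T (Suc n))) sums S \<and>
         (blinfun_apply S \<in> hilbert_space.closed_range_D smult ip M N \<longrightarrow>
          S \<in> hilbert_space.psi smult ip M N lam)))"
proof -
  interpret hilbert_space smult ip by (rule assms(1))
  note M = assms(2) and N = assms(3) and T = assms(5)
  have power_mem: "op_scale (\<alpha> n) (op_power T n) \<in> phi M N lam" if "n \<ge> 1" for n
    using phi_op_scale_power[OF M N T, of _ "n - 1"] that by simp
  show ?thesis
  proof (intro conjI ballI allI impI)
    show "op_scale (\<alpha> n) (op_power T n) \<in> phi M N lam" if "n \<ge> 1" for n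
      using that by (rule power_mem)
  next
    fix T' assume lim: "(\<lambda>n. op_scale (\<alpha> n) (op_power T n)) \<longlonglongrightarrow> T'"
    have "T' \<in> phi M N lam"
      \<comment> \<open>The shift by \<open>LIMSEQ_Suc\<close> drops index 0, where the term is a
        multiple of the identity and \<open>power_mem\<close> says nothing.\<close>
      by (rule phi_limit[OF M N _ LIMSEQ_Suc[OF lim]]) (simp add: power_mem del: op_power.simps)
    then show "T' \<in> psi M N lam" using phi_subset_psi[OF M N] by blast
  next
    fix n :: nat
    have "(\<Sum>i=1..n. op_scale (\<alpha> i) (op_power T i)) = (\<Sum>i<n. op_scale (\<alpha> (Suc i)) (op_power T (Suc i)))"
      by (simp add: sum.atLeast1_atMost_eq del: op_power.simps)
    also have "\<dots> \<in> phi M N lam" by (rule phi_power_sum[OF M N T])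
    finally show "(\<Sum>i=1..n. op_scale (\<alpha> i) (op_power T i)) \<in> psi M N lam"
      using phi_subset_psi[OF M N] by blast
  next
    assume "\<exists>\<beta><1. \<forall>n\<ge>1. root n (norm (\<alpha> n)) * norm T \<le> \<beta>"
    then have "summable (\<lambda>n. op_scale (\<alpha> (Suc n)) (op_power T (Suc n)))"
      using summable_op_power_series by blast
    then obtain S where S: "(\<lambda>n. op_scale (\<alpha> (Suc n)) (op_power T (Suc n))) sums S"
      unfolding summable_def by blast
    then have "S \<in> phi M N lam"
      \<comment> \<open>The partial sums are polynomials in \<open>T\<close> without constant term,
        so they lie in \<open>phi\<close>, and the norm limit stays there.\<close>
      unfolding sums_def by (rule phi_limit[OF M N phi_power_sum[OF M N T]])
    moreover from this have "S \<in> bounded_ops" by (simp add: phi_iff[OF M N])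
    ultimately show "\<exists>S\<in>bounded_ops. (\<lambda>n. op_scale (\<alpha> (Suc n)) (op_power T (Suc n))) sums S \<and>
        (blinfun_apply S \<in> closed_range_D M N \<longrightarrow> S \<in> psi M N lam)"
      using S phi_subset_psi[OF M N] by blast
  qed
qed

end
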